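(* Let $X$ be a real-valued random variable on a probability space $(\Omega, \mathcal{F}, \mathbb{P})$, and let $f, g : \mathbb{R} \to \mathbb{R}$ be non-decreasing functions such that the covariance $\operatorname{Cov}(f(X), g(X)) = \mathbb{E}[f(X) g(X)] - \mathbb{E}[f(X)]\,\mathbb{E}[g(X)]$ exists. Then $\operatorname{Cov}(f(X), g(X)) = 0$ if and only if at least one of the random variables $f(X)$, $g(X)$ is almost surely constant.
   Context: "Non-decreasing" means $x \le y$ implies $f(x) \le f(y)$ (not necessarily strictly). The covariance $\operatorname{Cov}(f(X), g(X))$ exists means that $f(X)$, $g(X)$ and the product $f(X)g(X)$ are all integrable with respect to $\mathbb{P}$. A random variable $Z$ is almost surely constant if there is $c \in \mathbb{R}$ with $\mathbb{P}(Z = c) = 1$. *)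

theory Defs
  imports "HOL-Probability.Probability"
begin

definition covariance_exists :: "'a measure \<Rightarrow> ('a \<Rightarrow> real) \<Rightarrow> ('a \<Rightarrow> real) \<Rightarrow> bool" where
  "covariance_exists M Y Z \<longleftrightarrow>
     integrable M Y \<and> integrable M Z \<and> integrable M (\<lambda>\<omega>. Y \<omega> * Z \<omega>)"

text \<open>Only meaningful under \<open>covariance_exists M Y Z\<close>: the Bochner integral of a
  non-integrable function is \<open>0\<close> by convention.\<close>

definition covariance :: "'a measure \<Rightarrow> ('a \<Rightarrow> real) \<Rightarrow> ('a \<Rightarrow> real) \<Rightarrow> real" where
  "covariance M Y Z =
     (\<integral>\<omega>. Y \<omega> * Z \<omega> \<partial>M) - (\<integral>\<omega>. Y \<omega> \<partial>M) * (\<integral>\<omega>. Z \<omega> \<partial>M)"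

definition almost_surely_constant :: "'a measure \<Rightarrow> ('a \<Rightarrow> real) \<Rightarrow> bool" where
  "almost_surely_constant M Z \<longleftrightarrow> (\<exists>c. measure M {\<omega> \<in> space M. Z \<omega> = c} = 1)"

end

theory Submission
  imports Defs
begin

text \<open>
  Write \<open>m\<close> for the mean of \<open>f(X)\<close>. As \<open>f(X) - m\<close> has mean zero, the covariance equals
  \<open>E[(f(X) - m) (g(X) - c)]\<close> for every constant \<open>c\<close>. Since both functions are non-decreasing,
  no value of \<open>g\<close> at a point where \<open>f < m\<close> exceeds a value of \<open>g\<close> at a point where
  \<open>f > m\<close>; a constant \<open>c\<close> that separates the two sets of values makes the product
  \<open>(f - m) (g - c)\<close> nonnegative everywhere. So zero covariance forces
  \<open>f(X) = m\<close> or \<open>g(X) = c\<close> almost surely.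

  It remains to exchange ``almost surely'' and ``or''. If \<open>f(X)\<close> is not almost surely constant,
  it lies below its mean with positive probability and above it with positive probability
  (otherwise \<open>f(X) - m\<close> would be a variable of constant sign with mean zero), and in both
  events \<open>g(X) = c\<close> almost surely. Hence there are points \<open>u\<close> with \<open>f u < m\<close> and \<open>v\<close>
  with \<open>f v > m\<close> at which \<open>g\<close> takes the value \<open>c\<close>. Every \<open>x\<close> with \<open>f x = m\<close> lies between \<open>u\<close> and
  \<open>v\<close>, so there also \<open>g x = c\<close>, and \<open>g(X)\<close> is almost surely constant.

  Conversely, if \<open>g(X) = c\<close> almost surely, the same formula with this \<open>c\<close> has an integrand that
  vanishes almost surely; the case of \<open>f(X)\<close> follows because covariance is symmetric.
\<close>

lemma almost_surely_constant_iff_AE: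
  assumes "prob_space M" and "Z \<in> borel_measurable M"
  shows "almost_surely_constant M Z \<longleftrightarrow> (\<exists>c. AE \<omega> in M. Z \<omega> = c)"
proof -
  interpret prob_space M by fact
  have "{\<omega> \<in> space M. Z \<omega> = c} \<in> sets M" for c
    using assms(2) by measurable
  then show ?thesis
    unfolding almost_surely_constant_def by (simp add: prob_Collect_eq_1)
qed

lemma covariance_commute: "covariance M Y Z = covariance M Z Y"
  by (simp add: covariance_def mult.commute)

lemma covariance_exists_commute: "covariance_exists M Y Z \<longleftrightarrow> covariance_exists M Z Y"
  by (auto simp: covariance_exists_def mult.commute)

text \<open>The free constant \<open>c\<close> is what later allows the integrand to be made nonnegative.\<close>

lemma covariance_eq_integral_centered:
  fixes Y Z :: "'a \<Rightarrow> real"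
  assumes "prob_space M" and "covariance_exists M Y Z"
  defines "m \<equiv> \<integral>\<omega>. Y \<omega> \<partial>M"
  shows "integrable M (\<lambda>\<omega>. (Y \<omega> - m) * (Z \<omega> - c))"
    and "covariance M Y Z = (\<integral>\<omega>. (Y \<omega> - m) * (Z \<omega> - c) \<partial>M)"
proof -
  interpret prob_space M by fact
  have [simp]: "integrable M Y" "integrable M Z" "integrable M (\<lambda>\<omega>. Y \<omega> * Z \<omega>)"
    using assms(2) by (auto simp: covariance_exists_def)
  have expand: "(Y \<omega> - m) * (Z \<omega> - c) = Y \<omega> * Z \<omega> - c * Y \<omega> - m * Z \<omega> + m * c" for \<omega>
    by (simp add: algebra_simps)
  show "integrable M (\<lambda>\<omega>. (Y \<omega> - m) * (Z \<omega> - c))"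
    unfolding expand by simp
  show "covariance M Y Z = (\<integral>\<omega>. (Y \<omega> - m) * (Z \<omega> - c) \<partial>M)"
    unfolding expand by (simp add: covariance_def m_def prob_space)
qed

lemma covariance_eq_0_if_AE_const:
  fixes Y Z :: "'a \<Rightarrow> real"
  assumes "prob_space M" and "covariance_exists M Y Z" and "AE \<omega> in M. Z \<omega> = c"
  shows "covariance M Y Z = 0"
proof -
  have "AE \<omega> in M. (Y \<omega> - (\<integral>\<omega>. Y \<omega> \<partial>M)) * (Z \<omega> - c) = 0"
    using assms(3) by eventually_elim simp
  then show ?thesis
    using covariance_eq_integral_centered(2)[OF assms(1,2), of c]
    by (simp add: integral_eq_zero_AE)
qed

lemma (in prob_space) AE_eq_expectation_if_AE_ge:
  fixes Y :: "'a \<Rightarrow> real"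
  assumes "integrable M Y" and "AE \<omega> in M. expectation Y \<le> Y \<omega>"
  shows "AE \<omega> in M. Y \<omega> = expectation Y"
proof -
  have "expectation (\<lambda>\<omega>. Y \<omega> - expectation Y) = 0"
    using assms(1) by (simp add: prob_space)
  then have "AE \<omega> in M. Y \<omega> - expectation Y = 0"
    using assms by (subst (asm) integral_nonneg_eq_0_iff_AE) auto
  then show ?thesis by simp
qed

lemma (in prob_space) AE_eq_expectation_if_AE_le:
  fixes Y :: "'a \<Rightarrow> real"
  assumes "integrable M Y" and "AE \<omega> in M. Y \<omega> \<le> expectation Y"
  shows "AE \<omega> in M. Y \<omega> = expectation Y"
  using AE_eq_expectation_if_AE_ge[of "\<lambda>\<omega>. - Y \<omega>"] assms by simp

text \<open>
  The supremum of \<open>g\<close> over \<open>{x. f x < m}\<close> serves as \<open>c\<close>: \<open>a\<close> makes this set nonempty, and the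
  value \<open>g b\<close> bounds \<open>g\<close> on it.
\<close>

lemma mono_separating_value:
  fixes f g :: "real \<Rightarrow> real"
  assumes "mono f" and "mono g" and "f a < m" and "m < f b"
  obtains c where "\<And>x. 0 \<le> (f x - m) * (g x - c)"
proof
  let ?c = "SUP x\<in>{x. f x < m}. g x"
  have le: "g x \<le> g y" if "f x < m" "m < f y" for x y
  proof -
    have "\<not> f y \<le> f x" using that by simp
    then have "\<not> y \<le> x" using monoD[OF assms(1)] by blast
    then show ?thesis by (intro monoD[OF assms(2)]) simp
  qed
  have below: "g x \<le> ?c" if "f x < m" for x
    using that le[OF _ assms(4)] by (intro cSUP_upper bdd_aboveI2[where M = "g b"]) auto
  have above: "?c \<le> g y" if "m < f y" for y
    using assms(3) le[OF _ that] by (intro cSUP_least) auto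
  show "0 \<le> (f x - m) * (g x - ?c)" for x
    using below[of x] above[of x]
    by (cases "f x" m rule: linorder_cases) (auto intro: mult_nonneg_nonneg mult_nonpos_nonpos)
qed

text \<open>The half that uses monotonicity: on its level set \<open>f = m\<close> the vanishing product says nothing
  about \<open>g\<close>, and the value of \<open>g\<close> there is squeezed between equal values on either side.\<close>

lemma covariance_mono_eq_0_imp_AE_const:
  fixes X :: "'a \<Rightarrow> real" and f g :: "real \<Rightarrow> real"
  assumes "prob_space M" and "mono f" and "mono g"
    and ex: "covariance_exists M (\<lambda>\<omega>. f (X \<omega>)) (\<lambda>\<omega>. g (X \<omega>))"
    and zero: "covariance M (\<lambda>\<omega>. f (X \<omega>)) (\<lambda>\<omega>. g (X \<omega>)) = 0"
    and nonconst: "\<And>c. \<not> (AE \<omega> in M. f (X \<omega>) = c)"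
  shows "\<exists>c. AE \<omega> in M. g (X \<omega>) = c"
proof -
  interpret prob_space M by fact
  define m where "m = expectation (\<lambda>\<omega>. f (X \<omega>))"
  have int_f: "integrable M (\<lambda>\<omega>. f (X \<omega>))"
    using ex by (simp add: covariance_exists_def)
  have no_AE_ge: "\<not> (AE \<omega> in M. m \<le> f (X \<omega>))"
    using AE_eq_expectation_if_AE_ge[OF int_f] nonconst unfolding m_def by blast
  have no_AE_le: "\<not> (AE \<omega> in M. f (X \<omega>) \<le> m)"
    using AE_eq_expectation_if_AE_le[OF int_f] nonconst unfolding m_def by blast
  from no_AE_ge obtain a where "f a < m"
    using AE_I2[of M "\<lambda>\<omega>. m \<le> f (X \<omega>)"] by (meson linorder_not_le)
  moreover from no_AE_le obtain b where "m < f b"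
    using AE_I2[of M "\<lambda>\<omega>. f (X \<omega>) \<le> m"] by (meson linorder_not_le)
  ultimately obtain c where nonneg: "\<And>x. 0 \<le> (f x - m) * (g x - c)"
    using mono_separating_value[OF assms(2,3)] by metis
  have "AE \<omega> in M. (f (X \<omega>) - m) * (g (X \<omega>) - c) = 0"
    using covariance_eq_integral_centered[OF assms(1) ex, of c] zero nonneg
    unfolding m_def[symmetric] by (simp add: integral_nonneg_eq_0_iff_AE)
  then have f_or_g: "AE \<omega> in M. f (X \<omega>) = m \<or> g (X \<omega>) = c"
    by simp
  \<comment> \<open>If \<open>g\<close> missed \<open>c\<close> on \<open>{x. f x < m}\<close>, then \<open>X\<close> would almost surely avoid that set;
    likewise for \<open>v\<close> on the other side.\<close>
  obtain u where u: "f u < m" "g u = c"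
  proof (rule ccontr)
    assume "\<not> thesis"
    then have "\<And>x. f x < m \<Longrightarrow> g x \<noteq> c" using that by blast
    then have "AE \<omega> in M. m \<le> f (X \<omega>)"
      using f_or_g by (auto elim!: eventually_mono simp: linorder_not_less[symmetric])
    with no_AE_ge show False by blast
  qed
  obtain v where v: "m < f v" "g v = c"
  proof (rule ccontr)
    assume "\<not> thesis"
    then have "\<And>x. m < f x \<Longrightarrow> g x \<noteq> c" using that by blast
    then have "AE \<omega> in M. f (X \<omega>) \<le> m"
      using f_or_g by (auto elim!: eventually_mono simp: linorder_not_less[symmetric])
    with no_AE_le show False by blast
  qed
  have level: "g x = c" if "f x = m" for x
  proof -
    have "u \<le> x" "x \<le> v"
      using monoD[OF assms(2), of x u] monoD[OF assms(2), of v x] u(1) v(1) that by linarith+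
    then show ?thesis
      using monoD[OF assms(3), of u x] monoD[OF assms(3), of x v] u(2) v(2) by simp
  qed
  have "AE \<omega> in M. g (X \<omega>) = c"
    using f_or_g by eventually_elim (use level in blast)
  then show ?thesis ..
qed

theorem theorem1p2:
  fixes M :: "'a measure" and X :: "'a \<Rightarrow> real" and f g :: "real \<Rightarrow> real"
  assumes "prob_space M"
    and "X \<in> borel_measurable M"
    and "mono f" and "mono g"
    and "covariance_exists M (\<lambda>\<omega>. f (X \<omega>)) (\<lambda>\<omega>. g (X \<omega>))"
  shows "covariance M (\<lambda>\<omega>. f (X \<omega>)) (\<lambda>\<omega>. g (X \<omega>)) = 0 \<longleftrightarrow>
     almost_surely_constant M (\<lambda>\<omega>. f (X \<omega>)) \<or> almost_surely_constant M (\<lambda>\<omega>. g (X \<omega>))"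
proof -
  have meas: "(\<lambda>\<omega>. f (X \<omega>)) \<in> borel_measurable M" "(\<lambda>\<omega>. g (X \<omega>)) \<in> borel_measurable M"
    using assms(5) by (auto simp: covariance_exists_def)
  note const_iff = meas[THEN almost_surely_constant_iff_AE[OF assms(1)]]
  show ?thesis
  proof
    assume "covariance M (\<lambda>\<omega>. f (X \<omega>)) (\<lambda>\<omega>. g (X \<omega>)) = 0"
    then show "almost_surely_constant M (\<lambda>\<omega>. f (X \<omega>)) \<or> almost_surely_constant M (\<lambda>\<omega>. g (X \<omega>))"
      unfolding const_iff
      using covariance_mono_eq_0_imp_AE_const[OF assms(1,3,4,5)] by blast
  next
    assume "almost_surely_constant M (\<lambda>\<omega>. f (X \<omega>)) \<or> almost_surely_constant M (\<lambda>\<omega>. g (X \<omega>))"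
    then show "covariance M (\<lambda>\<omega>. f (X \<omega>)) (\<lambda>\<omega>. g (X \<omega>)) = 0"
      unfolding const_iff
      using covariance_eq_0_if_AE_const[OF assms(1,5)]
        covariance_eq_0_if_AE_const[OF assms(1) assms(5)[THEN covariance_exists_commute[THEN iffD1]]]
      by (auto simp: covariance_commute)
  qed
qed

end
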